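(* Let $L$ be a locale equipped with a topology $\Omega(L)$ on its underlying set. Suppose that $\Omega(L)$ is contained in the Alexandrov topology of $L$. Then the map $\phi : \Omega(L) \to L$ defined by $$\phi(\mathcal{U}) = \bigvee\{a \in L \mid \exists b \in \mathcal{U},\ a \wedge b = 0\}$$ is a homomorphism of locales, i.e. a frame homomorphism (it preserves arbitrary joins and finite meets, including the top element).
   Context: A locale is a complete lattice $L$ in which finite meets distribute over arbitrary joins (a frame), with top $1$ and bottom $0$. By a homomorphism of locales is meant a frame homomorphism. The topology $\Omega(L)$ is itself regarded as a locale, ordered by inclusion. The Alexandrov topology of $L$ is the topology whose open sets are all the upward closed subsets of $L$. *)

theory Defs
  imports "HOL-Algebra.Complete_Lattice" "HOL-Analysis.Abstract_Topology"
begin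

text \<open>
  Not the type class \<open>complete_distrib_lattice\<close>, which is complete distributivity and
  hence strictly stronger than the frame law. Finite meets reduce to binary ones, since
  meeting with the empty meet is the identity.
\<close>

locale frame = Complete_Lattice.complete_lattice L for L (structure) +
  assumes meet_sup_distrib:
    "\<lbrakk>x \<in> carrier L; A \<subseteq> carrier L\<rbrakk> \<Longrightarrow> x \<sqinter> \<Squnion>A = \<Squnion>((\<lambda>a. x \<sqinter> a) ` A)"

text \<open>
  \<open>sup_pres\<close> covers the empty join (preservation of bottom), whereas \<open>meet_pres\<close> is about
  binary meets only, so that the top element is treated separately.
\<close>

definition frame_hom ::
    "('a, 'c) gorder_scheme \<Rightarrow> ('b, 'd) gorder_scheme \<Rightarrow> ('a \<Rightarrow> 'b) \<Rightarrow> bool" where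
  "frame_hom X Y f \<longleftrightarrow>
     frame X \<and> frame Y \<and> f \<in> carrier X \<rightarrow> carrier Y \<and>
     sup_pres X Y f \<and> meet_pres X Y f \<and> f \<top>\<^bsub>X\<^esub> = \<top>\<^bsub>Y\<^esub>"

definition opens_order :: "'a topology \<Rightarrow> 'a set gorder" where
  "opens_order T = \<lparr>carrier = {U. openin T U}, eq = (=), le = (\<subseteq>)\<rparr>"

definition alexandrov_topology :: "('a, 'b) gorder_scheme \<Rightarrow> 'a topology" where
  "alexandrov_topology L = topology (\<lambda>U. U \<subseteq> carrier L \<and>
     (\<forall>x\<in>U. \<forall>y\<in>carrier L. x \<sqsubseteq>\<^bsub>L\<^esub> y \<longrightarrow> y \<in> U))"

lemma openin_alexandrov_topology:
  "openin (alexandrov_topology L) U \<longleftrightarrow>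
     U \<subseteq> carrier L \<and> (\<forall>x\<in>U. \<forall>y\<in>carrier L. x \<sqsubseteq>\<^bsub>L\<^esub> y \<longrightarrow> y \<in> U)"
proof -
  have "istopology (\<lambda>U. U \<subseteq> carrier L \<and> (\<forall>x\<in>U. \<forall>y\<in>carrier L. x \<sqsubseteq>\<^bsub>L\<^esub> y \<longrightarrow> y \<in> U))"
    unfolding istopology_def by blast
  then show ?thesis
    unfolding alexandrov_topology_def by (simp add: topology_inverse')
qed

definition phi :: "('a, 'b) gorder_scheme \<Rightarrow> 'a set \<Rightarrow> 'a" where
  "phi L U = \<Squnion>\<^bsub>L\<^esub> {a \<in> carrier L. \<exists>b\<in>U. a \<sqinter>\<^bsub>L\<^esub> b = \<bottom>\<^bsub>L\<^esub>}"

end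

theory Submission
  imports Defs
begin

text \<open>
  Joins cause no difficulty, since the set of elements that are disjoint from some member of
  \<open>\<U>\<close> is a union of such sets whenever \<open>\<U>\<close> is. For binary meets, if \<open>a \<sqinter> b = \<bottom>\<close> with
  \<open>b \<in> \<U>\<close> and \<open>a' \<sqinter> b' = \<bottom>\<close> with \<open>b' \<in> \<V>\<close>, then \<open>b \<squnion> b'\<close> lies in \<open>\<U> \<inter> \<V>\<close>, because
  opens are upward closed, and it is disjoint from \<open>a \<sqinter> a'\<close>; two applications of the frame law
  give \<open>phi L \<U> \<sqinter> phi L \<V> \<sqsubseteq> phi L (\<U> \<inter> \<V>)\<close>. The bottom element belongs to the whole space and
  is disjoint from everything, so the top is preserved.
\<close>

context Complete_Lattice.complete_lattice
begin

text \<open>By antisymmetry the universal property fixes a join up to equality. This rule and its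
  dual for binary meets serve both in \<open>L\<close> and in the lattice of opens.\<close>

lemma sup_eqI:
  assumes "A \<subseteq> carrier L" "s \<in> carrier L" "\<And>x. x \<in> A \<Longrightarrow> x \<sqsubseteq> s"
    and "\<And>z. \<lbrakk>z \<in> carrier L; \<And>x. x \<in> A \<Longrightarrow> x \<sqsubseteq> z\<rbrakk> \<Longrightarrow> s \<sqsubseteq> z"
  shows "\<Squnion>A = s"
  using assms by (intro le_antisym sup_least assms(4) sup_upper sup_closed)

lemma meet_eqI:
  assumes "x \<in> carrier L" "y \<in> carrier L" "m \<in> carrier L" "m \<sqsubseteq> x" "m \<sqsubseteq> y"
    and "\<And>z. \<lbrakk>z \<in> carrier L; z \<sqsubseteq> x; z \<sqsubseteq> y\<rbrakk> \<Longrightarrow> z \<sqsubseteq> m"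
  shows "x \<sqinter> y = m"
  using assms by (intro le_antisym meet_le assms(6) meet_left meet_right meet_closed)

text \<open>Both sides have the same upper bounds, namely the common upper bounds of all the
  \<open>A i\<close>.\<close>

lemma sup_UN:
  assumes "\<And>i. i \<in> I \<Longrightarrow> A i \<subseteq> carrier L"
  shows "\<Squnion>(\<Union>i\<in>I. A i) = \<Squnion>((\<lambda>i. \<Squnion>(A i)) ` I)"
proof (rule sup_eqI)
  have carr: "(\<lambda>i. \<Squnion>(A i)) ` I \<subseteq> carrier L"
    using assms by auto
  then show "\<Squnion>((\<lambda>i. \<Squnion>(A i)) ` I) \<in> carrier L"
    by simp
  show "x \<sqsubseteq> \<Squnion>((\<lambda>i. \<Squnion>(A i)) ` I)" if "x \<in> (\<Union>i\<in>I. A i)" for x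
  proof -
    obtain i where i: "i \<in> I" "x \<in> A i" using \<open>x \<in> (\<Union>i\<in>I. A i)\<close> by blast
    have "x \<sqsubseteq> \<Squnion>(A i)" "\<Squnion>(A i) \<sqsubseteq> \<Squnion>((\<lambda>i. \<Squnion>(A i)) ` I)"
      using i assms carr by (auto intro: sup_upper)
    then show ?thesis
      using i assms carr by (meson le_trans subsetD sup_closed)
  qed
  show "\<Squnion>((\<lambda>i. \<Squnion>(A i)) ` I) \<sqsubseteq> z"
    if "z \<in> carrier L" "\<And>x. x \<in> (\<Union>i\<in>I. A i) \<Longrightarrow> x \<sqsubseteq> z" for z
    using that assms carr by (auto intro!: sup_least)
qed (use assms in blast)

lemma phi_closed: "phi L U \<in> carrier L"
  unfolding phi_def by (rule sup_closed) blast

lemma phi_mono: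
  assumes "U \<subseteq> V"
  shows "phi L U \<sqsubseteq> phi L V"
  unfolding phi_def using assms by (intro sup_least sup_upper sup_closed) blast+

lemma phi_Union: "phi L (\<Union>\<A>) = \<Squnion>(phi L ` \<A>)"
proof -
  have "{a \<in> carrier L. \<exists>b\<in>\<Union>\<A>. a \<sqinter> b = \<bottom>} =
      (\<Union>U\<in>\<A>. {a \<in> carrier L. \<exists>b\<in>U. a \<sqinter> b = \<bottom>})"
    by blast
  then show ?thesis
    using sup_UN[of \<A> "\<lambda>U. {a \<in> carrier L. \<exists>b\<in>U. a \<sqinter> b = \<bottom>}"]
    by (simp add: phi_def)
qed

lemma phi_carrier: "phi L (carrier L) = \<top>"
proof -
  have "a \<sqinter> \<bottom> = \<bottom>" if "a \<in> carrier L" for a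
    using that by (intro meet_eqI) auto
  then have "{a \<in> carrier L. \<exists>b\<in>carrier L. a \<sqinter> b = \<bottom>} = carrier L"
    using bottom_closed by blast
  then show ?thesis
    \<comment> \<open>\<open>weak_sup_carrier\<close> speaks of the equivalence of the order record,
      which \<open>eq_is_equal\<close> turns into equality.\<close>
    using weak_sup_carrier eq_is_equal by (simp add: phi_def)
qed

end

context frame
begin

lemma meet_sup_le:
  assumes "x \<in> carrier L" "A \<subseteq> carrier L" "z \<in> carrier L" "\<And>a. a \<in> A \<Longrightarrow> x \<sqinter> a \<sqsubseteq> z"
  shows "x \<sqinter> \<Squnion>A \<sqsubseteq> z"
  unfolding meet_sup_distrib[OF assms(1,2)]
  using assms by (intro sup_least) (auto intro: meet_closed)

text \<open>The frame law is applied once in each argument. It distributes over a join on the right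
  only, so commutativity brings \<open>\<Squnion>A\<close> there for the second use.\<close>

lemma sup_meet_sup_le:
  assumes "A \<subseteq> carrier L" "B \<subseteq> carrier L" "z \<in> carrier L"
    and "\<And>a b. \<lbrakk>a \<in> A; b \<in> B\<rbrakk> \<Longrightarrow> a \<sqinter> b \<sqsubseteq> z"
  shows "\<Squnion>A \<sqinter> \<Squnion>B \<sqsubseteq> z"
proof (rule meet_sup_le)
  show "\<Squnion>A \<sqinter> b \<sqsubseteq> z" if "b \<in> B" for b
  proof -
    have "b \<sqinter> \<Squnion>A \<sqsubseteq> z"
      using assms that by (intro meet_sup_le) (auto simp: meet_comm[of L b])
    then show ?thesis
      by (simp add: meet_comm[of L b])
  qed
qed (use assms in auto)

lemma meet_join_disjoint:
  assumes "a \<in> carrier L" "b \<in> carrier L" "a' \<in> carrier L" "b' \<in> carrier L"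
    and "a \<sqinter> b = \<bottom>" "a' \<sqinter> b' = \<bottom>"
  shows "(a \<sqinter> a') \<sqinter> (b \<squnion> b') = \<bottom>"
proof -
  have "(a \<sqinter> a') \<sqinter> b = a' \<sqinter> (a \<sqinter> b)"
    using assms(1-4) by (simp add: meet_comm[of L a a'] meet_assoc)
  then have "(a \<sqinter> a') \<sqinter> b \<sqsubseteq> \<bottom>"
    using assms by (simp add: meet_right)
  moreover have "(a \<sqinter> a') \<sqinter> b' \<sqsubseteq> \<bottom>"
    using assms by (simp add: meet_assoc meet_right)
  \<comment> \<open>A binary join is by definition the join of a pair, so the frame law leaves just
    the two meets bounded above.\<close>
  ultimately have "(a \<sqinter> a') \<sqinter> (b \<squnion> b') \<sqsubseteq> \<bottom>"
    unfolding join_def using assms(1-4) by (intro meet_sup_le) auto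
  then show ?thesis
    using assms(1-4) by (intro le_antisym) auto
qed

lemma phi_Int:
  assumes U: "openin (alexandrov_topology L) U" and V: "openin (alexandrov_topology L) V"
  shows "phi L (U \<inter> V) = phi L U \<sqinter> phi L V"
proof (rule le_antisym)
  show "phi L (U \<inter> V) \<sqsubseteq> phi L U \<sqinter> phi L V"
    by (intro meet_le phi_mono phi_closed) auto
  have "a \<sqinter> a' \<sqsubseteq> phi L (U \<inter> V)"
    if "a \<in> carrier L" "b \<in> U" "a \<sqinter> b = \<bottom>" "a' \<in> carrier L" "b' \<in> V" "a' \<sqinter> b' = \<bottom>"
    for a b a' b'
  proof -
    have carr: "b \<in> carrier L" "b' \<in> carrier L"
      using that U V by (auto simp: openin_alexandrov_topology)
    \<comment> \<open>Upward closure enters here: the join lies above \<open>b\<close>, a member of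
      \<open>U\<close>, and above \<open>b'\<close>, a member of \<open>V\<close>.\<close>
    then have "b \<squnion> b' \<in> U \<inter> V"
      using that U V unfolding openin_alexandrov_topology
      by (meson IntI join_closed join_left join_right)
    then show ?thesis
      unfolding phi_def using that carr meet_join_disjoint[of a b a' b']
      by (intro sup_upper) auto
  qed
  then show "phi L U \<sqinter> phi L V \<sqsubseteq> phi L (U \<inter> V)"
    \<comment> \<open>\<open>phi L (U \<inter> V)\<close> stays folded, as the bound to be checked
      on pairs.\<close>
    using phi_closed[of "U \<inter> V"] unfolding phi_def[of L U] phi_def[of L V]
    by (intro sup_meet_sup_le) auto
qed (auto intro: phi_closed meet_closed)

end

lemma complete_lattice_opens_order: "Complete_Lattice.complete_lattice (opens_order T)"
proof -
  interpret partial_order "opens_order T"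
    by unfold_locales (auto simp: opens_order_def)
  show ?thesis
  proof (rule complete_latticeI)
    fix A assume "A \<subseteq> carrier (opens_order T)"
    then have A: "\<And>U. U \<in> A \<Longrightarrow> openin T U"
      by (auto simp: opens_order_def)
    have "least (opens_order T) (\<Union>A) (Upper (opens_order T) A)"
      using A by (intro least_UpperI) (auto simp: opens_order_def Upper_def)
    then show "\<exists>s. least (opens_order T) s (Upper (opens_order T) A)" ..
    \<comment> \<open>An intersection of opens need not be open, so the meet is its interior; for
      empty \<open>A\<close> this is the whole space.\<close>
    have "greatest (opens_order T) (\<Union>{U. openin T U \<and> (\<forall>V\<in>A. U \<subseteq> V)}) (Lower (opens_order T) A)"
      using A by (intro greatest_LowerI) (auto simp: opens_order_def Lower_def)
    then show "\<exists>i. greatest (opens_order T) i (Lower (opens_order T) A)" ..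
  qed
qed

lemma sup_opens_order:
  assumes "A \<subseteq> {U. openin T U}"
  shows "\<Squnion>\<^bsub>opens_order T\<^esub> A = \<Union>A"
proof -
  interpret Complete_Lattice.complete_lattice "opens_order T"
    by (rule complete_lattice_opens_order)
  show ?thesis
    using assms by (intro sup_eqI) (auto simp: opens_order_def)
qed

lemma meet_opens_order:
  assumes "openin T U" "openin T V"
  shows "U \<sqinter>\<^bsub>opens_order T\<^esub> V = U \<inter> V"
proof -
  interpret Complete_Lattice.complete_lattice "opens_order T"
    by (rule complete_lattice_opens_order)
  show ?thesis
    using assms by (intro meet_eqI) (auto simp: opens_order_def)
qed

lemma top_opens_order: "\<top>\<^bsub>opens_order T\<^esub> = topspace T"
proof -
  interpret Complete_Lattice.complete_lattice "opens_order T"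
    by (rule complete_lattice_opens_order)
  show ?thesis
    using top_closed top_higher[of "topspace T"]
    by (auto simp: opens_order_def dest: openin_subset)
qed

text \<open>Once joins and binary meets are identified with unions and intersections, the frame law
  is distributivity of sets.\<close>

lemma frame_opens_order: "frame (opens_order T)"
proof -
  interpret Complete_Lattice.complete_lattice "opens_order T"
    by (rule complete_lattice_opens_order)
  show ?thesis
  proof
    fix U A assume "U \<in> carrier (opens_order T)" "A \<subseteq> carrier (opens_order T)"
    then have U: "openin T U" and A: "A \<subseteq> {V. openin T V}"
      by (auto simp: opens_order_def)
    have "(\<lambda>V. U \<sqinter>\<^bsub>opens_order T\<^esub> V) ` A = (\<lambda>V. U \<inter> V) ` A"
      using U A by (intro image_cong) (auto simp: meet_opens_order)
    \<comment> \<open>The identifications hold for open sets only, hence these side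
      conditions.\<close>
    moreover have "openin T (\<Union>A)" "(\<lambda>V. U \<inter> V) ` A \<subseteq> {V. openin T V}"
      using U A by auto
    ultimately show "U \<sqinter>\<^bsub>opens_order T\<^esub> \<Squnion>\<^bsub>opens_order T\<^esub> A =
        \<Squnion>\<^bsub>opens_order T\<^esub> ((\<lambda>V. U \<sqinter>\<^bsub>opens_order T\<^esub> V) ` A)"
      using U A by (auto simp: sup_opens_order meet_opens_order)
  qed
qed

theorem lemma2p1:
  fixes L :: "('a, 'b) gorder_scheme" and T :: "'a topology"
  assumes "frame L"
    and "topspace T = carrier L"
    and "{U. openin T U} \<subseteq> {U. openin (alexandrov_topology L) U}"
  shows "frame_hom (opens_order T) L (phi L)"
proof -
  interpret frame L by fact
  interpret opens: frame "opens_order T" by (rule frame_opens_order)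
  have carr: "carrier (opens_order T) = {U. openin T U}"
    by (simp add: opens_order_def)
  have "sup_pres (opens_order T) L (phi L)"
    unfolding sup_pres_def
    using complete_lattice_axioms opens.complete_lattice_axioms
    by (simp add: carr sup_opens_order phi_Union)
  moreover have "meet_pres (opens_order T) L (phi L)"
    unfolding meet_pres_def
    using lattice_axioms opens.lattice_axioms assms(3)
    by (auto simp: carr meet_opens_order intro!: phi_Int)
  ultimately show ?thesis
    unfolding frame_hom_def
    \<comment> \<open>The top of the opens is \<open>topspace T\<close>, which
      \<open>assms(2)\<close> turns into \<open>carrier L\<close> for
      \<open>phi_carrier\<close>.\<close>
    using frame_axioms frame_opens_order assms(1,2)
    by (simp add: top_opens_order phi_carrier phi_closed)
qed

end
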